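(* Let $(X,d)$ and $(Y,\rho)$ be $\mathbf{MCD}$-spaces. Then the following statements are equivalent. (i) $(X,d)$ and $(Y,\rho)$ are isometric. (ii) The representing trees $T_X=T_X(r_X,l_X)$ and $T_Y=T_Y(r_Y,l_Y)$ are isomorphic as labeled rooted trees. (iii) The trees $T_X(l_X)$ and $T_Y(l_Y)$ are isomorphic as labeled trees. (iv) The equality $C(X)=C(Y)$ holds. (v) The equality $D(X)=D(Y)$ holds.
   Context: $\mathbb{R}^+=[0,\infty)$. An ultrametric space is a metric space $(X,d)$ with $X$ non-empty whose metric satisfies $d(x,y)\le\max\{d(x,z),d(z,y)\}$ for all $x,y,z\in X$. Two metric spaces are isometric if there is a distance-preserving bijection between them. The distance set is $D(X)=\{d(x,y):x,y\in X\}$ (so $0\in D(X)$). The center of distances $C(X)$ is the set of all $t\in D(X)$ such that for each $p\in X$ there exists $x\in X$ with $d(p,x)=t$. An $\mathbf{MCD}$-space is a finite ultrametric space $(X,d)$ satisfying $|X|=2^{|C(X)|-1}$. Trees. A tree is a connected acyclic graph; a rooted tree $T(r)$ is a tree $T$ with a distinguished vertex $r$, the root. A labeled tree $T(l)$ is a tree $T$ with a labeling $l:V(T)\to\mathbb{R}^+$; a labeled rooted tree $T(r,l)$ is a rooted tree with such a labeling. An isomorphism of labeled trees $T_1(l_1)$ and $T_2(l_2)$ is a bijection $F:V(T_1)\to V(T_2)$ which preserves adjacency in both directions and satisfies $l_2(F(v))=l_1(v)$ for all $v\in V(T_1)$. An isomorphism of labeled rooted trees $T_1(r_1,l_1)$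 and $T_2(r_2,l_2)$ is an isomorphism $F$ of the labeled trees $T_1(l_1)$, $T_2(l_2)$ which in addition satisfies $F(r_1)=r_2$. For a vertex $v\ne r$ of $T(r)$ the direct predecessor of $v$ is the neighbor of $v$ on the path from $v$ to $r$; $v$ is then a direct successor of that vertex. A leaf of $T(r)$ is a vertex with no direct successors. Representing tree. For a finite metric space $(X,d)$ with $|X|\ge2$, the diametrical graph $G_X$ has vertex set $X$, with $u,v$ adjacent iff $d(u,v)=\operatorname{diam}X$. For a finite ultrametric space with $|X|\ge 2$, $G_X$ is a complete multipartite graph, i.e. for some $k\ge2$ the set $X$ is partitioned into non-empty parts $X_1,\dots,X_k$ such that two points are adjacent in $G_X$ iff they lie in different parts. The representing tree $T_X=T_X(r_X,l_X)$ of a finite ultrametric space $(X,d)$ is the labeled rooted tree whose vertices are subsets of $X$, constructed as follows: the root is $r_X:=X$ with label $l_X(X)=\operatorname{diam}X$; if $|X|=1$ the root is the only vertex; if $|X|\geq 2$, the direct successors of the root are the parts $X_1,\dots,X_k$ of $G_X$, labeled by $l_X(X_i)=\operatorname{diam}X_i$; nodes with label $0$ are leaves, and the procedure is repeated for each node $X_i$ of positive label, using the space $(X_i,d|_{X_i\times X_i})$, until all remaining nodes are leaves. $T_X(l_X)$ denotes the labeled tree obtained from $T_X(r_X,l_X)$ by forgetting the root. *)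

theory Defs
  imports "HOL-Analysis.Analysis"
begin

section \<open>Finite ultrametric spaces\<close>

locale Ultrametric_space = Metric_space M d
  for M :: "'a set" and d :: "'a \<Rightarrow> 'a \<Rightarrow> real" +
  assumes nonempty: "M \<noteq> {}"
    and ultrametric: "\<And>x y z. \<lbrakk>x \<in> M; y \<in> M; z \<in> M\<rbrakk> \<Longrightarrow> d x y \<le> max (d x z) (d z y)"

definition distance_set :: "'a set \<Rightarrow> ('a \<Rightarrow> 'a \<Rightarrow> real) \<Rightarrow> real set" where
  "distance_set M d = {d x y | x y. x \<in> M \<and> y \<in> M}"

definition center_of_distances :: "'a set \<Rightarrow> ('a \<Rightarrow> 'a \<Rightarrow> real) \<Rightarrow> real set" where
  "center_of_distances M d = {t \<in> distance_set M d. \<forall>p\<in>M. \<exists>x\<in>M. d p x = t}"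

text \<open>The natural-number subtraction below does not truncate: as \<open>M\<close> is finite and non-empty,
  the center of distances is finite and contains \<open>0\<close>.\<close>

locale MCD_space = Ultrametric_space M d
  for M :: "'a set" and d :: "'a \<Rightarrow> 'a \<Rightarrow> real" +
  assumes finite: "finite M"
    and card_eq: "card M = 2 ^ (card (center_of_distances M d) - 1)"

definition isometric ::
  "'a set \<Rightarrow> ('a \<Rightarrow> 'a \<Rightarrow> real) \<Rightarrow> 'b set \<Rightarrow> ('b \<Rightarrow> 'b \<Rightarrow> real) \<Rightarrow> bool" where
  "isometric M d N e \<longleftrightarrow>
    (\<exists>f. bij_betw f M N \<and> (\<forall>x\<in>M. \<forall>y\<in>M. e (f x) (f y) = d x y))"

text \<open>The analogue of \<^const>\<open>diameter\<close> for a metric that is not given by a type class.\<close>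

definition mdiameter :: "('a \<Rightarrow> 'a \<Rightarrow> real) \<Rightarrow> 'a set \<Rightarrow> real" where
  "mdiameter d S = (if S = {} then 0 else SUP (x,y)\<in>S\<times>S. d x y)"


section \<open>Graphs, labeled trees and their isomorphisms\<close>

text \<open>Undirected graphs; an edge is the set of its two ends. Isomorphism is defined for arbitrary
  labeled (rooted) graphs and used for trees only.\<close>

record 'v ugraph =
  vertices :: "'v set"
  edges :: "'v set set"

definition adjacent :: "('v, 'z) ugraph_scheme \<Rightarrow> 'v \<Rightarrow> 'v \<Rightarrow> bool" where
  "adjacent G u v \<longleftrightarrow> {u, v} \<in> edges G"

record 'v labeled_graph = "'v ugraph" +
  label :: "'v \<Rightarrow> real"

record 'v labeled_rooted_graph = "'v labeled_graph" +
  root_vertex :: 'v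

definition forget_root :: "'v labeled_rooted_graph \<Rightarrow> 'v labeled_graph" where
  "forget_root T = labeled_graph.truncate T"

definition labeled_isomorphism ::
  "'v labeled_graph \<Rightarrow> 'w labeled_graph \<Rightarrow> ('v \<Rightarrow> 'w) \<Rightarrow> bool" where
  "labeled_isomorphism T1 T2 F \<longleftrightarrow>
     bij_betw F (vertices T1) (vertices T2) \<and>
     (\<forall>u\<in>vertices T1. \<forall>v\<in>vertices T1. adjacent T1 u v \<longleftrightarrow> adjacent T2 (F u) (F v)) \<and>
     (\<forall>v\<in>vertices T1. label T2 (F v) = label T1 v)"

definition labeled_rooted_isomorphism ::
  "'v labeled_rooted_graph \<Rightarrow> 'w labeled_rooted_graph \<Rightarrow> ('v \<Rightarrow> 'w) \<Rightarrow> bool" where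
  "labeled_rooted_isomorphism T1 T2 F \<longleftrightarrow>
     labeled_isomorphism (forget_root T1) (forget_root T2) F \<and>
     F (root_vertex T1) = root_vertex T2"

definition labeled_isomorphic :: "'v labeled_graph \<Rightarrow> 'w labeled_graph \<Rightarrow> bool" where
  "labeled_isomorphic T1 T2 \<longleftrightarrow> (\<exists>F. labeled_isomorphism T1 T2 F)"

definition labeled_rooted_isomorphic ::
  "'v labeled_rooted_graph \<Rightarrow> 'w labeled_rooted_graph \<Rightarrow> bool" where
  "labeled_rooted_isomorphic T1 T2 \<longleftrightarrow> (\<exists>F. labeled_rooted_isomorphism T1 T2 F)"


section \<open>The representing tree\<close>

text \<open>Meaningful for \<open>S\<close> with at least two points, in which case there are no loops.\<close>

definition diametrical_graph :: "('a \<Rightarrow> 'a \<Rightarrow> real) \<Rightarrow> 'a set \<Rightarrow> 'a ugraph" where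
  "diametrical_graph d S =
     \<lparr>vertices = S, edges = {{u, v} | u v. u \<in> S \<and> v \<in> S \<and> d u v = mdiameter d S}\<rparr>"

text \<open>\<open>multipartite_parts G P\<close>: \<open>G\<close> is complete multipartite with set of parts \<open>P\<close>.
  The set \<open>P\<close> is determined by \<open>G\<close>; see \<open>multipartite_parts_unique\<close> and, for its existence in the
  case of a diametrical graph, \<open>multipartite_parts_diametrical_graph\<close>.\<close>

definition multipartite_parts :: "'v ugraph \<Rightarrow> 'v set set \<Rightarrow> bool" where
  "multipartite_parts G P \<longleftrightarrow>
     partition_on (vertices G) P \<and> finite P \<and> 2 \<le> card P \<and>
     (\<forall>u\<in>vertices G. \<forall>v\<in>vertices G. adjacent G u v \<longleftrightarrow> \<not> (\<exists>A\<in>P. u \<in> A \<and> v \<in> A))"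

definition direct_successor :: "('a \<Rightarrow> 'a \<Rightarrow> real) \<Rightarrow> 'a set \<Rightarrow> 'a set \<Rightarrow> bool" where
  "direct_successor d A B \<longleftrightarrow>
     0 < mdiameter d A \<and> (\<exists>P. multipartite_parts (diametrical_graph d A) P \<and> B \<in> P)"

inductive_set tree_nodes :: "'a set \<Rightarrow> ('a \<Rightarrow> 'a \<Rightarrow> real) \<Rightarrow> 'a set set"
  for M :: "'a set" and d :: "'a \<Rightarrow> 'a \<Rightarrow> real" where
  root: "M \<in> tree_nodes M d"
| successor: "\<lbrakk>A \<in> tree_nodes M d; direct_successor d A B\<rbrakk> \<Longrightarrow> B \<in> tree_nodes M d"

definition representing_tree :: "'a set \<Rightarrow> ('a \<Rightarrow> 'a \<Rightarrow> real) \<Rightarrow> 'a set labeled_rooted_graph" where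
  "representing_tree M d =
     \<lparr>vertices = tree_nodes M d,
      edges = {{A, B} | A B. A \<in> tree_nodes M d \<and> direct_successor d A B},
      label = mdiameter d,
      root_vertex = M\<rparr>"


subsection \<open>Well-definedness of the parts\<close>

lemma multipartite_parts_unique:
  assumes "multipartite_parts G P" and "multipartite_parts G Q"
  shows "P = Q"
proof -
  have sub: "P \<subseteq> Q" if P: "multipartite_parts G P" and Q: "multipartite_parts G Q" for P Q
  proof
    fix A assume A: "A \<in> P"
    note pP = P[unfolded multipartite_parts_def] and pQ = Q[unfolded multipartite_parts_def]
    obtain a where a: "a \<in> A"
      using A pP by (metis partition_onD3 ex_in_conv)
    have aV: "a \<in> vertices G"
      using A a pP by (auto dest: partition_onD1)
    then obtain B where B: "B \<in> Q" "a \<in> B"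
      using pQ partition_onD1[of "vertices G" Q] by blast
    have eqA: "A = {v \<in> vertices G. \<not> adjacent G a v}"
    proof (intro set_eqI iffI)
      fix v assume "v \<in> A"
      then show "v \<in> {v \<in> vertices G. \<not> adjacent G a v}"
        using A a aV pP by (auto dest: partition_onD1)
    next
      fix v assume "v \<in> {v \<in> vertices G. \<not> adjacent G a v}"
      then obtain A' where "A' \<in> P" "a \<in> A'" "v \<in> A'"
        using aV pP by blast
      moreover have "A' = A"
        using calculation A a pP partition_onD2[of _ P] unfolding disjoint_def by blast
      ultimately show "v \<in> A" by simp
    qed
    have eqB: "B = {v \<in> vertices G. \<not> adjacent G a v}"
    proof (intro set_eqI iffI)
      fix v assume "v \<in> B"
      then show "v \<in> {v \<in> vertices G. \<not> adjacent G a v}"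
        using B aV pQ by (auto dest: partition_onD1)
    next
      fix v assume "v \<in> {v \<in> vertices G. \<not> adjacent G a v}"
      then obtain B' where "B' \<in> Q" "a \<in> B'" "v \<in> B'"
        using aV pQ by blast
      moreover have "B' = B"
        using calculation B pQ partition_onD2[of _ Q] unfolding disjoint_def by blast
      ultimately show "v \<in> B" by simp
    qed
    show "A \<in> Q" using eqA eqB B by simp
  qed
  show ?thesis using sub assms by blast
qed

lemma (in Ultrametric_space) multipartite_parts_diametrical_graph:
  assumes A: "A \<subseteq> M" and fin: "finite A" and card: "2 \<le> card A"
  shows "\<exists>P. multipartite_parts (diametrical_graph d A) P"
proof -
  define D where "D = mdiameter d A"
  have Ane: "A \<noteq> {}" using card by auto
  have D_Max: "D = Max ((\<lambda>(x,y). d x y) ` (A \<times> A))"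
    using Ane fin unfolding D_def mdiameter_def by (auto intro!: cSup_eq_Max)
  have le: "d x y \<le> D" if "x \<in> A" "y \<in> A" for x y
    unfolding D_Max using fin that by (intro Max_ge) auto
  have "D \<in> (\<lambda>(x,y). d x y) ` (A \<times> A)"
    unfolding D_Max using fin Ane by (intro Max_in) auto
  then obtain p q where pq: "p \<in> A" "q \<in> A" "d p q = D" by auto
  obtain a b where ab: "a \<in> A" "b \<in> A" "a \<noteq> b"
    using card fin by (metis card_le_Suc0_iff_eq not_less_eq_eq numeral_2_eq_2)
  have Dpos: "0 < D"
    using le[of a b] ab A mdist_pos_less[of a b] by fastforce
  define r where "r = {(x,y). x \<in> A \<and> y \<in> A \<and> d x y < D}"
  have equiv: "equiv A r"
  proof (rule equivI)
    show "refl_on A r" using Dpos A by (auto simp: r_def refl_on_def subset_iff)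
    show "r \<subseteq> A \<times> A" by (auto simp: r_def)
    show "sym r" by (auto simp: r_def sym_def commute)
    show "trans r"
    proof (rule transI)
      fix x y z assume "(x,y) \<in> r" "(y,z) \<in> r"
      then show "(x,z) \<in> r"
        using ultrametric[of x z y] A by (fastforce simp: r_def)
    qed
  qed
  have part: "partition_on A (A // r)" by (rule partition_on_quotient[OF equiv])
  have finP: "finite (A // r)"
    using fin finite_elements[OF fin part] by simp
  have "(p,q) \<notin> r" using pq by (simp add: r_def)
  then have ne: "r `` {p} \<noteq> r `` {q}"
    using eq_equiv_class_iff[OF equiv] pq by simp
  have "{r `` {p}, r `` {q}} \<subseteq> A // r" using pq by (auto intro: quotientI)
  then have two: "2 \<le> card (A // r)"
    using card_mono[OF finP, of "{r `` {p}, r `` {q}}"] ne by simp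
  have adj: "adjacent (diametrical_graph d A) u v \<longleftrightarrow> \<not> (\<exists>B\<in>A // r. u \<in> B \<and> v \<in> B)"
    if uv: "u \<in> A" "v \<in> A" for u v
  proof -
    have "adjacent (diametrical_graph d A) u v \<longleftrightarrow> d u v = D"
      using uv by (auto simp: adjacent_def diametrical_graph_def D_def doubleton_eq_iff commute)
    also have "\<dots> \<longleftrightarrow> (u,v) \<notin> r"
      using uv le[of u v] by (auto simp: r_def)
    also have "\<dots> \<longleftrightarrow> \<not> (\<exists>B\<in>A // r. u \<in> B \<and> v \<in> B)"
    proof -
      have "(u,v) \<in> r" if "B \<in> A // r" "u \<in> B" "v \<in> B" for B
        using quotient_eq_iff[OF equiv that(1) that(1) that(2) that(3)] by simp
      moreover have "\<exists>B\<in>A // r. u \<in> B \<and> v \<in> B" if "(u,v) \<in> r"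
        using that uv equiv_class_self[OF equiv uv(1)] by (intro bexI[of _ "r `` {u}"]) (auto intro: quotientI)
      ultimately show ?thesis by blast
    qed
    finally show ?thesis .
  qed
  have "multipartite_parts (diametrical_graph d A) (A // r)"
    using part finP two adj unfolding multipartite_parts_def
    by (simp add: diametrical_graph_def)
  then show ?thesis ..
qed

end

theory Submission
  imports Defs
begin

text \<open>
  Call a finite ultrametric space \<open>M\<close> extremal for a finite set \<open>K\<close> of positive reals if every
  point of \<open>M\<close> realises every \<open>t \<in> K\<close> as a distance and \<open>M\<close> has only \<open>2 ^ card K\<close> points. An
  \<open>MCD\<close>-space is extremal for its non-zero central distances. What makes the theorem work is that
  \<open>K\<close> alone determines an extremal space, up to isometry.

  Let \<open>t\<close> be the largest element of \<open>K\<close> and choose \<open>p\<close>, \<open>q\<close> with \<open>d p q = t\<close>. The open balls of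
  radius \<open>t\<close> about \<open>p\<close> and \<open>q\<close> are disjoint, and inside each of them every point still realises
  every element of \<open>K - {t}\<close>. By induction each ball has at least \<open>2 ^ (card K - 1)\<close> points
  (\<open>card_ge_if_realises\<close>), so an extremal space is exactly the union of the two balls, all distances
  across are \<open>t\<close>, and each ball is extremal for \<open>K - {t}\<close> (\<open>extremal_split\<close>). Recursion down this
  binary splitting shows that the distances are \<open>0\<close> and the elements of \<open>K\<close>
  (\<open>distance_set_extremal\<close>), so that \<open>D(X) = C(X)\<close>, and glues isometries of the halves to an
  isometry of the whole spaces (\<open>isometric_extremal\<close>).

  For the trees: an isometry acts on the nodes by taking images
  (\<open>labeled_rooted_isomorphic_if_isometric\<close>), and conversely the labels of the nodes of the
  representing tree are exactly the distances of the space (\<open>labels_representing_tree\<close>), so already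
  an isomorphism of unrooted labeled trees gives \<open>D(X) = D(Y)\<close>.
\<close>

section \<open>Extremal ultrametric spaces\<close>

definition realises :: "'a set \<Rightarrow> ('a \<Rightarrow> 'a \<Rightarrow> real) \<Rightarrow> real set \<Rightarrow> bool" where
  "realises M d K \<longleftrightarrow> (\<forall>p\<in>M. \<forall>t\<in>K. \<exists>x\<in>M. d p x = t)"

lemma Ultrametric_space_subset:
  assumes "Ultrametric_space M d" "A \<subseteq> M" "A \<noteq> {}"
  shows "Ultrametric_space A d"
proof -
  interpret Ultrametric_space M d by fact
  have "Metric_space A d" using assms(2) by (rule subspace)
  then show ?thesis
    unfolding Ultrametric_space_def Ultrametric_space_axioms_def
    using assms ultrametric by (meson subsetD)
qed

context Ultrametric_space
begin

text \<open>In an ultrametric triangle the two longest sides are equal, so an end of a pair can be moved by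
  less than the distance of the pair without changing that distance. This makes two open balls of
  radius \<open>t\<close> with centres at distance \<open>t\<close> disjoint, with all distances across equal to \<open>t\<close>.\<close>

lemma dist_eq_if_close:
  assumes "a \<in> M" "b \<in> M" "p \<in> M" "q \<in> M" "d p q = t" "d p a < t" "d q b < t"
  shows "d a b = t"
proof (rule antisym)
  have "d a q \<le> max (d a p) (d p q)" "d a b \<le> max (d a q) (d q b)"
    using assms ultrametric by auto
  then show "d a b \<le> t" using assms commute[of a p] by linarith
  have "d p q \<le> max (d p a) (d a q)" "d a q \<le> max (d a b) (d b q)"
    using assms ultrametric by auto
  then show "t \<le> d a b" using assms commute[of b q] by linarith
qed

lemma Ultrametric_space_mball:
  assumes "p \<in> M" "0 < t"
  shows "Ultrametric_space (mball p t) d"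
proof (rule Ultrametric_space_subset)
  show "Ultrametric_space M d" by unfold_locales
  show "mball p t \<noteq> {}" using assms by (force simp: mball_def)
qed (auto simp: mball_def)

text \<open>A distance below the radius never leads out of an ultrametric ball.\<close>

lemma realises_mball:
  assumes "p \<in> M" "realises M d K" "\<forall>s\<in>K. s < t"
  shows "realises (mball p t) d K"
  unfolding realises_def
proof (intro ballI)
  fix a s assume a: "a \<in> mball p t" and s: "s \<in> K"
  then have "a \<in> M" by (simp add: mball_def)
  then obtain x where x: "x \<in> M" "d a x = s"
    using assms(2) s unfolding realises_def by blast
  have "d p x \<le> max (d p a) (d a x)"
    using a x assms by (intro ultrametric) (auto simp: mball_def)
  then have "x \<in> mball p t" using a x s assms by (auto simp: mball_def)
  then show "\<exists>x\<in>mball p t. d a x = s" using x by blast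
qed

lemma disjoint_mballs:
  assumes "p \<in> M" "q \<in> M" "d p q = t" "0 < t"
  shows "mball p t \<inter> mball q t = {}"
proof -
  have False if "x \<in> mball p t" "x \<in> mball q t" for x
    using that dist_eq_if_close[of x x p q t] assms by (auto simp: mball_def)
  then show ?thesis by blast
qed

end

text \<open>Each new largest distance \<open>t\<close> doubles the bound: two points at distance \<open>t\<close> are centres of
  disjoint balls of radius \<open>t\<close>, and each ball still realises all the smaller distances.\<close>

lemma card_ge_if_realises:
  fixes d :: "'a \<Rightarrow> 'a \<Rightarrow> real"
  assumes "finite K" "Ultrametric_space M d" "finite M" "realises M d K" "\<forall>t\<in>K. 0 < t"
  shows "2 ^ card K \<le> card M"
  using assms
proof (induction K arbitrary: M rule: finite_linorder_max_induct)
  case empty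
  then show ?case
    using Ultrametric_space.nonempty[of M d] by (simp add: Suc_le_eq card_gt_0_iff)
next
  case (insert t K)
  interpret Ultrametric_space M d by fact
  obtain p where p: "p \<in> M" using nonempty by blast
  then obtain q where q: "q \<in> M" "d p q = t"
    using insert.prems by (auto simp: realises_def)
  have t: "0 < t" using insert.prems by simp
  have K: "realises M d K" using insert.prems by (simp add: realises_def)
  have fin: "finite (mball x t)" for x
    using mball_subset_mspace insert.prems(2) by (rule finite_subset)
  have ball: "2 ^ card K \<le> card (mball x t)" if "x \<in> M" for x
    using insert.IH[OF Ultrametric_space_mball[OF that t] fin]
      realises_mball[OF that K] insert.hyps insert.prems by simp
  have "card (mball p t \<union> mball q t)
      = card (mball p t) + card (mball q t)"
    using disjoint_mballs[OF p q t] fin by (simp add: card_Un_disjoint)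
  moreover have "card (mball p t \<union> mball q t) \<le> card M"
    using insert.prems by (intro card_mono) (auto simp: mball_def)
  moreover have "card (insert t K) = Suc (card K)" using insert.hyps by auto
  ultimately show ?case using ball[OF p] ball[OF q(1)] by simp
qed

definition extremal :: "'a set \<Rightarrow> ('a \<Rightarrow> 'a \<Rightarrow> real) \<Rightarrow> real set \<Rightarrow> bool" where
  "extremal M d K \<longleftrightarrow>
     Ultrametric_space M d \<and> finite M \<and> realises M d K \<and> (\<forall>t\<in>K. 0 < t) \<and> card M = 2 ^ card K"

text \<open>Equality in \<open>card_ge_if_realises\<close> leaves room for nothing but the two balls, which must
  themselves attain the bound.\<close>

lemma extremal_split:
  assumes ext: "extremal M d (insert t K)" and "finite K" and less: "\<forall>s\<in>K. s < t"
  obtains A B where "M = A \<union> B" "A \<inter> B = {}" "extremal A d K" "extremal B d K"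
    "\<forall>a\<in>A. \<forall>b\<in>B. d a b = t"
proof -
  interpret Ultrametric_space M d using ext by (simp add: extremal_def)
  have finM: "finite M" and real: "realises M d (insert t K)" and pos: "\<forall>s\<in>insert t K. 0 < s"
    and cardM: "card M = 2 ^ card (insert t K)"
    using ext by (auto simp: extremal_def)
  obtain p where p: "p \<in> M" using nonempty by blast
  then obtain q where q: "q \<in> M" "d p q = t" using real by (auto simp: realises_def)
  have t: "0 < t" using pos by simp
  have K: "realises M d K" using real by (simp add: realises_def)
  define U where "U x = mball x t" for x
  have fin: "finite (U x)" for x unfolding U_def using mball_subset_mspace finM by (rule finite_subset)
  have sub: "U p \<union> U q \<subseteq> M" by (auto simp: U_def mball_def)
  have U: "Ultrametric_space (U x) d" "realises (U x) d K" if "x \<in> M" for x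
    using Ultrametric_space_mball[OF that t] realises_mball[OF that K less]
    by (auto simp: U_def)
  have ge: "2 ^ card K \<le> card (U x)" if "x \<in> M" for x
    using card_ge_if_realises[OF \<open>finite K\<close> U(1)[OF that] fin U(2)[OF that]] pos by simp
  have disj: "U p \<inter> U q = {}"
    using disjoint_mballs[OF p q t] by (simp add: U_def)
  have sum: "card (U p \<union> U q) = card (U p) + card (U q)"
    using disj fin by (simp add: card_Un_disjoint)
  have le: "card (U p \<union> U q) \<le> card M" using finM sub by (rule card_mono)
  have "t \<notin> K" using less by auto
  then have M2: "card M = 2 * 2 ^ card K" using cardM \<open>finite K\<close> by simp
  have eqs: "card (U p) = 2 ^ card K" "card (U q) = 2 ^ card K"
    using sum le M2 ge[OF p] ge[OF q(1)] by linarith+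
  show ?thesis
  proof (rule that)
    show "M = U p \<union> U q"
      using card_subset_eq[OF finM sub] sum eqs M2 by simp
    show "extremal (U p) d K" "extremal (U q) d K"
      using U[OF p] U[OF q(1)] eqs fin pos by (auto simp: extremal_def)
    show "\<forall>a\<in>U p. \<forall>b\<in>U q. d a b = t"
      using dist_eq_if_close[of _ _ p q t] p q by (auto simp: U_def mball_def)
  qed (fact disj)
qed

lemma extremal_empty_singleton:
  assumes "extremal M d {}"
  obtains x where "M = {x}" "d x x = 0"
proof -
  interpret Ultrametric_space M d using assms by (simp add: extremal_def)
  obtain x where "M = {x}"
    using assms by (auto simp: extremal_def card_1_singleton_iff)
  then show ?thesis using that by auto
qed

lemma distance_set_eq_image: "distance_set M d = (\<lambda>(x,y). d x y) ` (M \<times> M)"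
  by (auto simp: distance_set_def)

lemma distance_set_extremal:
  assumes "finite K" "extremal M d K"
  shows "distance_set M d = insert 0 K"
  using assms
proof (induction K arbitrary: M rule: finite_linorder_max_induct)
  case empty
  then show ?case by (elim extremal_empty_singleton) (auto simp: distance_set_def)
next
  case (insert t K)
  interpret Ultrametric_space M d using insert.prems by (simp add: extremal_def)
  obtain A B where AB: "M = A \<union> B" "extremal A d K" "extremal B d K"
    "\<forall>a\<in>A. \<forall>b\<in>B. d a b = t"
    using extremal_split[OF insert.prems] insert.hyps by metis
  have "A \<noteq> {}" "B \<noteq> {}"
    using AB Ultrametric_space.nonempty unfolding extremal_def by blast+
  have ba: "\<forall>a\<in>A. \<forall>b\<in>B. d b a = t" using AB(4) commute by metis
  have "distance_set M d = insert t (distance_set A d \<union> distance_set B d)"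
  proof (intro equalityI subsetI)
    fix r assume "r \<in> distance_set M d"
    then obtain x y where "x \<in> A \<union> B" "y \<in> A \<union> B" "r = d x y"
      unfolding distance_set_def AB(1) by blast
    then show "r \<in> insert t (distance_set A d \<union> distance_set B d)"
      using AB(4) ba unfolding distance_set_def by blast
  next
    obtain a b where "a \<in> A" "b \<in> B" using \<open>A \<noteq> {}\<close> \<open>B \<noteq> {}\<close> by blast
    then have "a \<in> M" "b \<in> M" "d a b = t" using AB(1,4) by auto
    then have "t \<in> distance_set M d" unfolding distance_set_def by blast
    moreover fix r assume "r \<in> insert t (distance_set A d \<union> distance_set B d)"
    ultimately show "r \<in> distance_set M d" using AB(1) unfolding distance_set_def by blast
  qed
  then show ?case using insert.IH[OF AB(2)] insert.IH[OF AB(3)] by auto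
qed

text \<open>The halves of both spaces are matched by induction; the glued map is an isometry because the
  distance across is the same number \<open>t\<close> in both spaces.\<close>

lemma isometric_extremal:
  fixes d :: "'a \<Rightarrow> 'a \<Rightarrow> real" and e :: "'b \<Rightarrow> 'b \<Rightarrow> real"
  assumes "finite K" "extremal M d K" "extremal N e K"
  shows "isometric M d N e"
  using assms
proof (induction K arbitrary: M N rule: finite_linorder_max_induct)
  case empty
  obtain x y where "M = {x}" "d x x = 0" "N = {y}" "e y y = 0"
    using empty by (metis extremal_empty_singleton)
  then show ?case
    unfolding isometric_def by (intro exI[of _ "\<lambda>_. y"]) (auto simp: bij_betw_def)
next
  case (insert t K)
  interpret M: Ultrametric_space M d using insert.prems by (simp add: extremal_def)
  interpret N: Ultrametric_space N e using insert.prems by (simp add: extremal_def)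
  obtain A B where AB: "M = A \<union> B" "A \<inter> B = {}" "extremal A d K" "extremal B d K"
    "\<forall>a\<in>A. \<forall>b\<in>B. d a b = t"
    using extremal_split[OF insert.prems(1)] insert.hyps by metis
  obtain A' B' where AB': "N = A' \<union> B'" "A' \<inter> B' = {}" "extremal A' e K" "extremal B' e K"
    "\<forall>a\<in>A'. \<forall>b\<in>B'. e a b = t"
    using extremal_split[OF insert.prems(2)] insert.hyps by metis
  obtain f where f: "bij_betw f A A'" "\<forall>x\<in>A. \<forall>y\<in>A. e (f x) (f y) = d x y"
    using insert.IH[OF AB(3) AB'(3)] by (auto simp: isometric_def)
  obtain g where g: "bij_betw g B B'" "\<forall>x\<in>B. \<forall>y\<in>B. e (g x) (g y) = d x y"
    using insert.IH[OF AB(4) AB'(4)] by (auto simp: isometric_def)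
  define h where "h x = (if x \<in> A then f x else g x)" for x
  have hA: "h x = f x" "f x \<in> A'" if "x \<in> A" for x
    using that bij_betw_apply[OF f(1)] by (auto simp: h_def)
  have hB: "h x = g x" "g x \<in> B'" if "x \<in> B" for x
    using that AB(2) bij_betw_apply[OF g(1)] by (auto simp: h_def)
  have "bij_betw h A A'" "bij_betw h B B'"
    using f(1) g(1) hA hB bij_betw_cong[of A h f] bij_betw_cong[of B h g] by auto
  then have bij: "bij_betw h M N"
    using bij_betw_combine AB(1) AB'(1,2) by metis
  have across: "e (h a) (h b) = d a b" "e (h b) (h a) = d b a" if "a \<in> A" "b \<in> B" for a b
    using that hA hB AB(5) AB'(5) M.commute[of b a] N.commute[of "h b" "h a"] by simp_all
  have "e (h x) (h y) = d x y" if "x \<in> M" "y \<in> M" for x y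
    using that across f(2) g(2) hA hB unfolding AB(1) by auto
  then show ?case using bij unfolding isometric_def by blast
qed

section \<open>Central distances of extremal spaces\<close>

lemma (in Metric_space) zero_in_center_of_distances:
  assumes "M \<noteq> {}"
  shows "0 \<in> center_of_distances M d"
proof -
  have "d p p = 0" if "p \<in> M" for p using that by simp
  then show ?thesis
    using assms unfolding center_of_distances_def distance_set_def by (blast intro: sym)
qed

context MCD_space
begin

lemma finite_distance_set: "finite (distance_set M d)"
  using finite by (simp add: distance_set_eq_image)

lemma finite_center_of_distances: "finite (center_of_distances M d)"
  using finite_distance_set by (rule rev_finite_subset) (auto simp: center_of_distances_def)

lemma extremal_center_of_distances: "extremal M d (center_of_distances M d - {0})"
  unfolding extremal_def
proof (intro conjI)
  show "Ultrametric_space M d" by unfold_locales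
  show "finite M" by (fact finite)
  show "realises M d (center_of_distances M d - {0})"
    by (auto simp: realises_def center_of_distances_def)
  have "0 \<le> t" if "t \<in> center_of_distances M d" for t
    using that nonneg by (auto simp: center_of_distances_def distance_set_def)
  then show "\<forall>t\<in>center_of_distances M d - {0}. 0 < t" by (auto simp: order_less_le)
  show "card M = 2 ^ card (center_of_distances M d - {0})"
    using card_eq zero_in_center_of_distances[OF nonempty] by simp
qed

lemma distance_set_eq_center: "distance_set M d = center_of_distances M d"
  using distance_set_extremal[OF _ extremal_center_of_distances] finite_center_of_distances
    zero_in_center_of_distances[OF nonempty] by auto

end

lemma isometric_if_center_eq:
  assumes "MCD_space X d" "MCD_space Y \<rho>" "center_of_distances X d = center_of_distances Y \<rho>"
  shows "isometric X d Y \<rho>"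
  using isometric_extremal MCD_space.finite_center_of_distances
    MCD_space.extremal_center_of_distances assms by (metis finite_Diff)

lemma dist_image_preserved:
  assumes "\<forall>x\<in>A. \<forall>y\<in>A. e (f x) (f y) = d x y"
  shows "(\<lambda>(x,y). e x y) ` (f ` A \<times> f ` A) = (\<lambda>(x,y). d x y) ` (A \<times> A)"
proof -
  have "f ` A \<times> f ` A = map_prod f f ` (A \<times> A)" by auto
  then show ?thesis using assms by (simp only: image_image) (rule image_cong, auto)
qed

lemma distance_set_eq_if_isometric:
  assumes "isometric M d N e"
  shows "distance_set M d = distance_set N e"
proof -
  obtain f where f: "f ` M = N" "\<forall>x\<in>M. \<forall>y\<in>M. e (f x) (f y) = d x y"
    using assms by (auto simp: isometric_def bij_betw_def)
  then show ?thesis using dist_image_preserved[of M e f d] by (simp add: distance_set_eq_image)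
qed

section \<open>Isometries and representing trees\<close>

lemma direct_successor_subset:
  assumes "direct_successor d A B"
  shows "B \<subseteq> A"
proof -
  obtain P where "partition_on A P" "B \<in> P"
    using assms by (auto simp: direct_successor_def multipartite_parts_def diametrical_graph_def)
  then show ?thesis using partition_onD1 by blast
qed

lemma tree_nodes_subset:
  assumes "A \<in> tree_nodes M d"
  shows "A \<subseteq> M"
  using assms by (induction rule: tree_nodes.induct) (auto dest: direct_successor_subset)

lemma mdiameter_image:
  assumes "\<forall>x\<in>A. \<forall>y\<in>A. e (f x) (f y) = d x y"
  shows "mdiameter e (f ` A) = mdiameter d A"
  using dist_image_preserved[of A e f d, OF assms] by (simp add: mdiameter_def)

lemma multipartite_parts_image:
  assumes inj: "inj_on f A" and iso: "\<forall>x\<in>A. \<forall>y\<in>A. e (f x) (f y) = d x y"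
    and sym: "\<And>x y. d x y = d y x"  "\<And>x y. e x y = e y x"
    and P: "multipartite_parts (diametrical_graph d A) P"
  shows "multipartite_parts (diametrical_graph e (f ` A)) ((`) f ` P)"
proof -
  have part: "partition_on A P" and fin: "finite P" and two: "2 \<le> card P"
    and adj: "\<forall>u\<in>A. \<forall>v\<in>A. adjacent (diametrical_graph d A) u v \<longleftrightarrow> \<not> (\<exists>B\<in>P. u \<in> B \<and> v \<in> B)"
    using P by (auto simp: multipartite_parts_def diametrical_graph_def)
  have PA: "P \<subseteq> Pow A" using partition_onD1[OF part] by blast
  have "inj_on ((`) f) P" using inj_on_image_Pow[OF inj] PA by (rule inj_on_subset)
  then have "card ((`) f ` P) = card P" by (rule card_image)
  moreover have "partition_on (f ` A) ((`) f ` P)"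
    using partition_on_inj_image[OF part inj] partition_onD3[OF part]
    by (simp add: image_iff)
  moreover have "adjacent (diametrical_graph e (f ` A)) (f u) (f v)
      \<longleftrightarrow> \<not> (\<exists>B\<in>(`) f ` P. f u \<in> B \<and> f v \<in> B)" if uv: "u \<in> A" "v \<in> A" for u v
  proof -
    have "adjacent (diametrical_graph e (f ` A)) (f u) (f v) \<longleftrightarrow> e (f u) (f v) = mdiameter e (f ` A)"
      using uv sym(2) by (auto simp: adjacent_def diametrical_graph_def doubleton_eq_iff)
    also have "\<dots> \<longleftrightarrow> d u v = mdiameter d A" using uv iso mdiameter_image[of A e f d, OF iso] by simp
    also have "\<dots> \<longleftrightarrow> adjacent (diametrical_graph d A) u v"
      using uv sym(1) by (auto simp: adjacent_def diametrical_graph_def doubleton_eq_iff)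
    also have "\<dots> \<longleftrightarrow> \<not> (\<exists>B\<in>P. u \<in> B \<and> v \<in> B)" using adj uv by blast
    also have "\<dots> \<longleftrightarrow> \<not> (\<exists>B\<in>(`) f ` P. f u \<in> B \<and> f v \<in> B)"
    proof -
      have "f w \<in> f ` B \<longleftrightarrow> w \<in> B" if "w \<in> A" "B \<in> P" for w B
        using that PA inj by (intro inj_on_image_mem_iff) auto
      then show ?thesis using uv by auto
    qed
    finally show ?thesis .
  qed
  ultimately show ?thesis
    using fin two by (auto simp: multipartite_parts_def diametrical_graph_def)
qed

lemma direct_successor_image:
  assumes "inj_on f A" and iso: "\<forall>x\<in>A. \<forall>y\<in>A. e (f x) (f y) = d x y"
    and "\<And>x y. d x y = d y x"  "\<And>x y. e x y = e y x"
    and "direct_successor d A B"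
  shows "direct_successor e (f ` A) (f ` B)"
  using assms(5) multipartite_parts_image[of f A e d, OF assms(1-4)] mdiameter_image[of A e f d, OF iso]
  unfolding direct_successor_def by (metis imageI)

text \<open>Only the forward implications are stated; their converses follow by applying the lemma to the
  inverse isometry.\<close>

lemma representing_tree_image:
  assumes inj: "inj_on f M" and iso: "\<forall>x\<in>M. \<forall>y\<in>M. e (f x) (f y) = d x y"
    and sym: "\<And>x y. d x y = d y x"  "\<And>x y. e x y = e y x"
  shows tree_nodes_image: "A \<in> tree_nodes M d \<Longrightarrow> f ` A \<in> tree_nodes (f ` M) e"
    and adjacent_image: "adjacent (representing_tree M d) A B
      \<Longrightarrow> adjacent (representing_tree (f ` M) e) (f ` A) (f ` B)"
proof -
  have succ: "direct_successor e (f ` A) (f ` B)"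
    if "A \<in> tree_nodes M d" "direct_successor d A B" for A B
  proof (rule direct_successor_image)
    have "A \<subseteq> M" using that by (simp add: tree_nodes_subset)
    then show "inj_on f A" "\<forall>x\<in>A. \<forall>y\<in>A. e (f x) (f y) = d x y"
      using inj iso by (auto intro: inj_on_subset)
  qed (use sym that in auto)
  have nodes: "f ` A \<in> tree_nodes (f ` M) e" if "A \<in> tree_nodes M d" for A
    using that
  proof (induction rule: tree_nodes.induct)
    case root
    show ?case by (rule tree_nodes.root)
  next
    case (successor A B)
    then show ?case using succ tree_nodes.successor by metis
  qed
  show "A \<in> tree_nodes M d \<Longrightarrow> f ` A \<in> tree_nodes (f ` M) e" by (fact nodes)
  assume "adjacent (representing_tree M d) A B"
  then obtain A' B' where *: "{A, B} = {A', B'}" "A' \<in> tree_nodes M d" "direct_successor d A' B'"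
    by (auto simp: adjacent_def representing_tree_def)
  then have "{f ` A, f ` B} = {f ` A', f ` B'}" by (auto simp: doubleton_eq_iff)
  moreover have "f ` A' \<in> tree_nodes (f ` M) e" "direct_successor e (f ` A') (f ` B')"
    using * nodes succ by auto
  ultimately show "adjacent (representing_tree (f ` M) e) (f ` A) (f ` B)"
    unfolding adjacent_def representing_tree_def by auto
qed

lemma labeled_rooted_isomorphic_if_isometric:
  assumes "Metric_space M d" "Metric_space N e" "isometric M d N e"
  shows "labeled_rooted_isomorphic (representing_tree M d) (representing_tree N e)"
proof -
  interpret M: Metric_space M d by fact
  interpret N: Metric_space N e by fact
  obtain f where bij: "bij_betw f M N" and iso: "\<forall>x\<in>M. \<forall>y\<in>M. e (f x) (f y) = d x y"
    using assms(3) by (auto simp: isometric_def)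
  define g where "g = inv_into M f"
  have gbij: "bij_betw g N M" unfolding g_def using bij by (rule bij_betw_inv_into)
  have gf: "g (f x) = x" if "x \<in> M" for x
    using that bij by (simp add: g_def bij_betw_def)
  have fg: "f (g y) = y" if "y \<in> N" for y
    using that bij by (simp add: g_def bij_betw_inv_into_right)
  have giso: "\<forall>x\<in>N. \<forall>y\<in>N. d (g x) (g y) = e x y"
    using iso fg bij_betw_apply[OF gbij] by metis
  have fM: "f ` M = N" "inj_on f M" and gN: "g ` N = M" "inj_on g N"
    using bij gbij by (auto simp: bij_betw_def)
  have gfA: "g ` f ` A = A" if "A \<in> tree_nodes M d" for A
  proof -
    have "g ` f ` A = (\<lambda>x. x) ` A"
      unfolding image_image using gf tree_nodes_subset[OF that] by (intro image_cong) auto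
    then show ?thesis by simp
  qed
  have fgA: "f ` g ` A = A" if "A \<in> tree_nodes N e" for A
  proof -
    have "f ` g ` A = (\<lambda>x. x) ` A"
      unfolding image_image using fg tree_nodes_subset[OF that] by (intro image_cong) auto
    then show ?thesis by simp
  qed
  note f_img = representing_tree_image[of f M e d, OF fM(2) iso M.commute N.commute, unfolded fM(1)]
  note g_img = representing_tree_image[of g N d e, OF gN(2) giso N.commute M.commute, unfolded gN(1)]
  have bij_nodes: "bij_betw ((`) f) (tree_nodes M d) (tree_nodes N e)"
    by (rule bij_betw_byWitness[where f' = "(`) g"]) (use gfA fgA f_img(1) g_img(1) in auto)
  have adj: "adjacent (representing_tree M d) A B
      \<longleftrightarrow> adjacent (representing_tree N e) (f ` A) (f ` B)"
    if "A \<in> tree_nodes M d" "B \<in> tree_nodes M d" for A B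
    using f_img(2)[of A B] g_img(2)[of "f ` A" "f ` B"] gfA that by auto
  have lab: "mdiameter e (f ` A) = mdiameter d A" if "A \<in> tree_nodes M d" for A
    using iso tree_nodes_subset[OF that] by (intro mdiameter_image) blast
  have "labeled_rooted_isomorphism (representing_tree M d) (representing_tree N e) ((`) f)"
    using bij_nodes adj lab fM(1)
    unfolding labeled_rooted_isomorphism_def labeled_isomorphism_def
    by (simp add: forget_root_def labeled_graph.truncate_def representing_tree_def adjacent_def)
  then show ?thesis unfolding labeled_rooted_isomorphic_def by blast
qed

section \<open>The labels of the representing tree\<close>

lemma mdiameter_eq_Max:
  assumes "finite A" "A \<noteq> {}"
  shows "mdiameter d A = Max ((\<lambda>(x,y). d x y) ` (A \<times> A))"
  using assms unfolding mdiameter_def by (auto intro!: cSup_eq_Max)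

lemma mdiameter_attained:
  assumes "finite A" "A \<noteq> {}"
  obtains x y where "x \<in> A" "y \<in> A" "d x y = mdiameter d A"
proof -
  have "Max ((\<lambda>(x,y). d x y) ` (A \<times> A)) \<in> (\<lambda>(x,y). d x y) ` (A \<times> A)"
    using assms by (intro Max_in) auto
  then show ?thesis using that mdiameter_eq_Max[OF assms, of d] by auto
qed

lemma le_mdiameter:
  assumes "finite A" "x \<in> A" "y \<in> A"
  shows "d x y \<le> mdiameter d A"
proof -
  have "d x y \<le> Max ((\<lambda>(x,y). d x y) ` (A \<times> A))"
    using assms by (intro Max_ge) auto
  moreover have "A \<noteq> {}" using assms by blast
  ultimately show ?thesis using assms mdiameter_eq_Max[of A d] by simp
qed

lemma tree_nodes_nonempty:
  assumes "A \<in> tree_nodes M d" "M \<noteq> {}"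
  shows "A \<noteq> {}"
  using assms
proof (cases rule: tree_nodes.cases)
  case (successor A')
  then show ?thesis
    using partition_onD3 by (auto simp: direct_successor_def multipartite_parts_def)
qed simp

text \<open>Two points at a distance smaller than the diameter of a node lie in a common direct successor
  of that node, which is a smaller set; hence the descent ends at a node whose diameter is exactly
  their distance.\<close>

lemma (in Ultrametric_space) ex_node_mdiameter_eq:
  assumes "finite M" "A \<in> tree_nodes M d" "x \<in> A" "y \<in> A"
  shows "\<exists>B\<in>tree_nodes M d. mdiameter d B = d x y"
  using assms(2-)
proof (induction "card A" arbitrary: A rule: less_induct)
  case less
  have AM: "A \<subseteq> M" using less.prems by (simp add: tree_nodes_subset)
  have finA: "finite A" using AM assms(1) by (rule finite_subset)
  show ?case
  proof (cases "mdiameter d A = d x y")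
    case True
    then show ?thesis using less.prems by blast
  next
    case False
    then have lt: "d x y < mdiameter d A"
      using le_mdiameter[OF finA less.prems(2,3), of d] by simp
    obtain u v where uv: "u \<in> A" "v \<in> A" "d u v = mdiameter d A"
      using mdiameter_attained[OF finA] less.prems by blast
    have pos: "0 < mdiameter d A" using lt nonneg[of x y] by linarith
    then have "u \<noteq> v" using uv AM by auto
    then have "2 \<le> card A"
      using card_mono[OF finA, of "{u, v}"] uv by simp
    then obtain P where P: "multipartite_parts (diametrical_graph d A) P"
      using multipartite_parts_diametrical_graph[OF AM finA] by blast
    have "\<not> adjacent (diametrical_graph d A) x y"
      using lt by (auto simp: adjacent_def diametrical_graph_def doubleton_eq_iff commute)
    then obtain B where B: "B \<in> P" "x \<in> B" "y \<in> B"
      using P less.prems by (auto simp: multipartite_parts_def diametrical_graph_def)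
    have "adjacent (diametrical_graph d A) u v"
      using uv by (auto simp: adjacent_def diametrical_graph_def)
    then have "\<not> (u \<in> B \<and> v \<in> B)"
      using P uv B by (auto simp: multipartite_parts_def diametrical_graph_def)
    moreover have succ: "direct_successor d A B"
      using pos P B by (auto simp: direct_successor_def)
    ultimately have "B \<subset> A" using uv direct_successor_subset by blast
    then have "card B < card A" using finA by (rule psubset_card_mono[rotated])
    moreover have "B \<in> tree_nodes M d" using less.prems(1) succ by (rule tree_nodes.successor)
    ultimately show ?thesis using less.hyps B by blast
  qed
qed

lemma (in Ultrametric_space) labels_representing_tree:
  assumes "finite M"
  shows "label (representing_tree M d) ` vertices (representing_tree M d) = distance_set M d"
proof -
  have "mdiameter d A \<in> distance_set M d" if A: "A \<in> tree_nodes M d" for A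
  proof -
    have AM: "A \<subseteq> M" "A \<noteq> {}"
      using tree_nodes_subset[OF A] tree_nodes_nonempty[OF A nonempty] by auto
    then obtain x y where "x \<in> A" "y \<in> A" "d x y = mdiameter d A"
      using mdiameter_attained[of A d] assms finite_subset by metis
    then show ?thesis using AM unfolding distance_set_def by (blast intro: sym)
  qed
  moreover have "r \<in> mdiameter d ` tree_nodes M d" if "r \<in> distance_set M d" for r
    using that ex_node_mdiameter_eq[OF assms tree_nodes.root]
    by (force simp: distance_set_def image_iff)
  ultimately show ?thesis by (auto simp: representing_tree_def)
qed

lemma labels_eq_if_labeled_isomorphic:
  assumes "labeled_isomorphic T1 T2"
  shows "label T1 ` vertices T1 = label T2 ` vertices T2"
proof -
  obtain F where F: "F ` vertices T1 = vertices T2" "\<forall>v\<in>vertices T1. label T2 (F v) = label T1 v"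
    using assms by (auto simp: labeled_isomorphic_def labeled_isomorphism_def bij_betw_def)
  then show ?thesis by (auto simp: F(1)[symmetric] image_image)
qed

lemma labeled_isomorphic_forget_root:
  assumes "labeled_rooted_isomorphic T1 T2"
  shows "labeled_isomorphic (forget_root T1) (forget_root T2)"
  using assms
  by (auto simp: labeled_rooted_isomorphic_def labeled_rooted_isomorphism_def labeled_isomorphic_def)

lemma distance_set_eq_if_labeled_isomorphic:
  assumes "Ultrametric_space M d" "finite M" "Ultrametric_space N e" "finite N"
    and "labeled_isomorphic (forget_root (representing_tree M d)) (forget_root (representing_tree N e))"
  shows "distance_set M d = distance_set N e"
  using labels_eq_if_labeled_isomorphic[OF assms(5)]
    Ultrametric_space.labels_representing_tree[OF assms(1,2)]
    Ultrametric_space.labels_representing_tree[OF assms(3,4)]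
  by (simp add: forget_root_def labeled_graph.truncate_def representing_tree_def)

section \<open>Equivalence of isometry, tree isomorphism and equality of distances\<close>

theorem theorem4p2:
  fixes X :: "'a set" and d :: "'a \<Rightarrow> 'a \<Rightarrow> real"
    and Y :: "'b set" and \<rho> :: "'b \<Rightarrow> 'b \<Rightarrow> real"
  assumes "MCD_space X d" and "MCD_space Y \<rho>"
  shows "(isometric X d Y \<rho> \<longleftrightarrow>
            labeled_rooted_isomorphic (representing_tree X d) (representing_tree Y \<rho>)) \<and>
         (isometric X d Y \<rho> \<longleftrightarrow>
            labeled_isomorphic (forget_root (representing_tree X d))
                               (forget_root (representing_tree Y \<rho>))) \<and>
         (isometric X d Y \<rho> \<longleftrightarrow> center_of_distances X d = center_of_distances Y \<rho>) \<and>
         (isometric X d Y \<rho> \<longleftrightarrow> distance_set X d = distance_set Y \<rho>)"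
proof -
  interpret X: MCD_space X d by fact
  interpret Y: MCD_space Y \<rho> by fact
  have "isometric X d Y \<rho> \<Longrightarrow>
      labeled_rooted_isomorphic (representing_tree X d) (representing_tree Y \<rho>)"
    using labeled_rooted_isomorphic_if_isometric X.Metric_space_axioms Y.Metric_space_axioms
    by blast
  moreover have "labeled_isomorphic (forget_root (representing_tree X d))
      (forget_root (representing_tree Y \<rho>)) \<Longrightarrow> distance_set X d = distance_set Y \<rho>"
    using distance_set_eq_if_labeled_isomorphic X.Ultrametric_space_axioms X.finite
      Y.Ultrametric_space_axioms Y.finite by blast
  moreover have "isometric X d Y \<rho> \<longleftrightarrow> center_of_distances X d = center_of_distances Y \<rho>"
    using isometric_if_center_eq[OF assms] distance_set_eq_if_isometric[of X d Y \<rho>]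
      X.distance_set_eq_center Y.distance_set_eq_center by auto
  ultimately show ?thesis
    using labeled_isomorphic_forget_root X.distance_set_eq_center Y.distance_set_eq_center by metis
qed

end
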